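(* Let $n\ge 4$ and $1\le k\le n-3$. Let $J$ be the $U(n)$-invariant almost complex structure on the full flag manifold $F(n)=U(n)/T$ whose associated tournament $\mathcal T(J)$ on the players $\{1,\dots,n\}$ is given by: $n\to i$ for $i=1,\dots,k$, and $i\to j$ for every other pair $i<j$ (that is, for all $i<j$ with $j\ne n$ or $i>k$). Let $ds^2_\Lambda$ be the invariant metric on $F(n)$ determined by the matrix $\Lambda=(\lambda_{ij})$. Then $ds^2_\Lambda$ is $(1,2)$-symplectic with respect to $J$ if and only if both of the following hold: (1) for all $1\le i<j\le n$, except the pairs $(i,j)=(1,n),(2,n),\dots,(k,n)$, $$\lambda_{ij}=\lambda_{i(i+1)}+\lambda_{(i+1)(i+2)}+\cdots+\lambda_{(j-1)j};$$ (2) for all $2\le i\le k$, $$\lambda_{in}=\lambda_{12}+\lambda_{23}+\cdots+\lambda_{(i-1)i}+\lambda_{1n}.$$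
   Context: $F(n)=U(n)/T$, where $T=U(1)\times\cdots\times U(1)$ ($n$ factors) is the diagonal maximal torus of $U(n)$; $U(n)$ acts on the left. The tangent space at the base point $T$ is identified with $\mathfrak p=\{A=(a_{ij})\in\mathfrak u(n): a_{ii}=0 \text{ for all } i\}$. Invariant almost complex structures: a $U(n)$-invariant almost complex structure on $F(n)$ is given by an $\mathrm{Ad}(T)$-equivariant linear map $J:\mathfrak p\to\mathfrak p$ with $J^2=-I$. Such $J$ has the form $J(a_{ij})=(a'_{ij})$ with, for each $i<j$, $a'_{ij}=\sqrt{-1}\,a_{ij}$ or $a'_{ij}=-\sqrt{-1}\,a_{ij}$. Tournaments: an $n$-tournament on $\{1,\dots,n\}$ is a choice, for each pair $i\neq j$, of exactly one of $i\to j$ or $j\to i$. The tournament $\mathcal T(J)$ associated to $J$ is defined, for $i<j$, by $i\to j$ if $a'_{ij}=\sqrt{-1}\,a_{ij}$ and $j\to i$ if $a'_{ij}=-\sqrt{-1}\,a_{ij}$. Invariant metrics: for a real symmetric matrix $\Lambda=(\lambda_{ij})$ with $\lambda_{ij}>0$ for $i\ne j$ and $\lambda_{ii}=0$, $ds^2_\Lambda=\sum_{i,j}\lambda_{ij}\,\omega_{i\bar\jmath}\otimes\omega_{\bar\imath j}$, where the $\omega_{i\bar\jmath}$ are the Maurer–Cartan forms of $U(n)$ and $\omega_{\bar\imath j}=\overline{\omega_{i\bar\jmath}}$; equivalently, it is the $U(n)$-invariant Riemannian metric on $F(n)$ given on $\mathfrak p$ by $ds^2_\Lambda(A,B)=\sum_{i,j}\lambda_{ij}a_{ij}\overline{b_{ij}}$.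 It is almost Hermitian for every invariant $J$. $(1,2)$-symplectic: the Kähler form is $\Omega(X,Y)=ds^2_\Lambda(X,JY)$. The metric $ds^2_\Lambda$ is $(1,2)$-symplectic with respect to $J$ if $(d\Omega)^{1,2}=0$, where $(\cdot)^{1,2}$ denotes the component of type $(1,2)$ in the decomposition of complex-valued 3-forms determined by $J$. *)

theory Defs
  imports "HOL-Analysis.Analysis"
begin

text \<open>
  Matrices are indexed by a finite type \<open>'n\<close> with \<open>n = CARD('n)\<close>; the players \<open>1, \<dots>, n\<close> are
  attached to the indices by a bijection \<open>e\<close> from \<open>{1..n}\<close> to \<open>'n\<close>.
\<close>

type_synonym 'n cmat = "complex ^ 'n ^ 'n"

definition ctranspose :: "'n::finite cmat \<Rightarrow> 'n cmat" where
  "ctranspose A = map_matrix cnj (transpose A)"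

definition unitary_group :: "'n::finite cmat set" where
  "unitary_group = {g. ctranspose g ** g = mat 1 \<and> g ** ctranspose g = mat 1}"

definition torus :: "'n::finite cmat set" where
  "torus = {t \<in> unitary_group. \<forall>i j. i \<noteq> j \<longrightarrow> t $ i $ j = 0}"

definition flag_manifold :: "'n::finite cmat set set" where
  "flag_manifold = {(\<lambda>t. g ** t) ` torus | g. g \<in> unitary_group}"

definition pspace :: "'n::finite cmat set" where
  "pspace = {A. ctranspose A = - A \<and> (\<forall>i. A $ i $ i = 0)}"

definition Ad :: "'n::finite cmat \<Rightarrow> 'n cmat \<Rightarrow> 'n cmat" where
  "Ad t A = t ** A ** matrix_inv t"

text \<open>Only the values of \<open>J\<close> on \<open>pspace\<close> matter; outside it \<open>J\<close> is arbitrary.\<close>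

definition invariant_acs :: "('n::finite cmat \<Rightarrow> 'n cmat) \<Rightarrow> bool" where
  "invariant_acs J \<longleftrightarrow>
     (\<forall>A\<in>pspace. J A \<in> pspace) \<and>
     (\<forall>A\<in>pspace. \<forall>B\<in>pspace. J (A + B) = J A + J B) \<and>
     (\<forall>c::real. \<forall>A\<in>pspace. J (c *\<^sub>R A) = c *\<^sub>R J A) \<and>
     (\<forall>t\<in>torus. \<forall>A\<in>pspace. J (Ad t A) = Ad t (J A)) \<and>
     (\<forall>A\<in>pspace. J (J A) = - A)"

text \<open>\<open>beats e J i j\<close> is the arc \<open>i \<rightarrow> j\<close> of the tournament of \<open>J\<close>.\<close>

definition beats :: "(nat \<Rightarrow> 'n::finite) \<Rightarrow> ('n cmat \<Rightarrow> 'n cmat) \<Rightarrow> nat \<Rightarrow> nat \<Rightarrow> bool" where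
  "beats e J i j \<longleftrightarrow>
     (i < j \<and> (\<forall>A\<in>pspace. J A $ e i $ e j = \<i> * A $ e i $ e j)) \<or>
     (j < i \<and> (\<forall>A\<in>pspace. J A $ e j $ e i = - \<i> * A $ e j $ e i))"

definition metric_matrix :: "real ^ 'n ^ 'n \<Rightarrow> bool" where
  "metric_matrix L \<longleftrightarrow> (\<forall>i j. L $ i $ j = L $ j $ i) \<and>
     (\<forall>i j. i \<noteq> j \<longrightarrow> 0 < L $ i $ j) \<and> (\<forall>i. L $ i $ i = 0)"

definition inv_metric :: "real ^ 'n ^ 'n \<Rightarrow> 'n::finite cmat \<Rightarrow> 'n cmat \<Rightarrow> complex" where
  "inv_metric L A B = (\<Sum>i\<in>UNIV. \<Sum>j\<in>UNIV. of_real (L $ i $ j) * A $ i $ j * cnj (B $ i $ j))"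

definition kaehler :: "real ^ 'n ^ 'n \<Rightarrow> ('n::finite cmat \<Rightarrow> 'n cmat) \<Rightarrow> 'n cmat \<Rightarrow> 'n cmat \<Rightarrow> complex"
  where "kaehler L J A B = inv_metric L A (J B)"

text \<open>
  A form on \<open>F(n) = U(n)/T\<close> is handled through its pull-back along \<open>\<pi> : U(n) \<rightarrow> F(n)\<close>, which
  commutes with \<open>d\<close>. A tangent vector at \<open>gT\<close> is written \<open>d\<pi>\<^sub>g(gA)\<close> with \<open>A \<in> \<pp>\<close>, where \<open>\<pp>\<close> is
  \<open>pspace\<close>; another representative \<open>gt\<close> of the coset replaces \<open>A\<close> by \<open>Ad(t\<^sup>-\<^sup>1)A\<close>.

  The pull-back of an invariant form given on \<open>\<pp>\<close> is obtained by inserting the \<open>\<pp>\<close>-component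
  of the Maurer-Cartan form \<open>g\<^sup>-\<^sup>1dg\<close>. In order to differentiate, this form is
  extended to \<open>GL(n, \<complex>)\<close>, an open subset of the real vector space of all matrices, by
  composing with the projection of \<open>\<gg>\<ll>(n, \<complex>)\<close> onto \<open>\<pp>\<close>, which on \<open>\<uu>(n)\<close>
  just deletes the diagonal. Since \<open>d\<close> commutes with the restriction to the submanifold
  \<open>U(n)\<close>, the values of the exterior derivative on vectors \<open>gA\<close> with \<open>A \<in> \<uu>(n)\<close>
  are those of the exterior derivative on \<open>U(n)\<close>.
\<close>

definition p_part :: "'n::finite cmat \<Rightarrow> 'n cmat" where
  "p_part A = (\<chi> i j. if i = j then 0 else (A $ i $ j - cnj (A $ j $ i)) / 2)"

definition maurer_cartan :: "'n::finite cmat \<Rightarrow> 'n cmat \<Rightarrow> 'n cmat" where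
  "maurer_cartan g X = matrix_inv g ** X"

definition invariant_form ::
    "('n::finite cmat \<Rightarrow> 'n cmat \<Rightarrow> complex) \<Rightarrow> 'n cmat \<Rightarrow> 'n cmat \<Rightarrow> 'n cmat \<Rightarrow> complex" where
  "invariant_form b g X Y = b (p_part (maurer_cartan g X)) (p_part (maurer_cartan g Y))"

lemma matrix_inv_eqI:
  fixes A B :: "'n::finite cmat"
  assumes "A ** B = mat 1" "B ** A = mat 1"
  shows "matrix_inv A = B"
proof -
  have "A ** matrix_inv A = mat 1 \<and> matrix_inv A ** A = mat 1"
    unfolding matrix_inv_def by (rule someI[of _ B]) (use assms in simp)
  then have "matrix_inv A = (B ** A) ** matrix_inv A" and "A ** matrix_inv A = mat 1"
    using assms by auto
  then show ?thesis by (metis matrix_mul_assoc matrix_mul_rid)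
qed

lemma matrix_inv_unitary:
  "g \<in> unitary_group \<Longrightarrow> matrix_inv g = ctranspose g"
  by (rule matrix_inv_eqI) (auto simp: unitary_group_def)

lemma ctranspose_mult: "ctranspose (A ** B) = ctranspose B ** ctranspose A"
  by (simp add: ctranspose_def vec_eq_iff transpose_def matrix_matrix_mult_def mult.commute)

lemma unitary_mult:
  assumes "g \<in> unitary_group" "h \<in> unitary_group"
  shows "g ** h \<in> unitary_group"
proof -
  have "ctranspose h ** (ctranspose g ** g) ** h = mat 1"
    "g ** (h ** ctranspose h) ** ctranspose g = mat 1"
    using assms by (simp_all add: unitary_group_def)
  then show ?thesis
    by (simp add: unitary_group_def ctranspose_mult matrix_mul_assoc)
qed

lemma diag_conj_nth:
  assumes t: "t \<in> torus"
  shows "(ctranspose t ** A ** t) $ i $ j = cnj (t $ i $ i) * A $ i $ j * t $ j $ j"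
proof -
  have d: "t $ a $ b = 0" if "a \<noteq> b" for a b
    using t that by (simp add: torus_def)
  have "(ctranspose t ** A) $ i $ b = cnj (t $ i $ i) * A $ i $ b" for b
  proof -
    have "(ctranspose t ** A) $ i $ b = (\<Sum>a\<in>UNIV. cnj (t $ a $ i) * A $ a $ b)"
      by (simp add: matrix_matrix_mult_def ctranspose_def transpose_def)
    also have "\<dots> = (\<Sum>a\<in>UNIV. if a = i then cnj (t $ i $ i) * A $ i $ b else 0)"
      by (rule sum.cong) (auto simp: d)
    finally show ?thesis by simp
  qed
  then have "(ctranspose t ** A ** t) $ i $ j =
      (\<Sum>b\<in>UNIV. cnj (t $ i $ i) * A $ i $ b * t $ b $ j)"
    by (simp add: matrix_matrix_mult_def)
  also have "\<dots> = (\<Sum>b\<in>UNIV. if b = j then cnj (t $ i $ i) * A $ i $ j * t $ j $ j else 0)"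
    by (rule sum.cong) (auto simp: d)
  finally show ?thesis by simp
qed

lemma torus_diag_norm:
  assumes t: "t \<in> torus"
  shows "t $ i $ i * cnj (t $ i $ i) = 1"
proof -
  have d: "t $ a $ b = 0" if "a \<noteq> b" for a b
    using t that by (simp add: torus_def)
  have "(\<Sum>b\<in>UNIV. t $ i $ b * cnj (t $ i $ b)) = (t ** ctranspose t) $ i $ i"
    by (simp add: matrix_matrix_mult_def ctranspose_def transpose_def)
  also have "\<dots> = 1" using t by (simp add: torus_def unitary_group_def mat_def)
  also have "(\<Sum>b\<in>UNIV. t $ i $ b * cnj (t $ i $ b)) =
      (\<Sum>b\<in>UNIV. if b = i then t $ i $ i * cnj (t $ i $ i) else 0)"
    by (rule sum.cong) (auto simp: d)
  finally show ?thesis by simp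
qed

lemma ctranspose_nth: "ctranspose A $ i $ j = cnj (A $ j $ i)"
  by (simp add: ctranspose_def transpose_def)

lemma ctranspose_ctranspose: "ctranspose (ctranspose A) = A"
  by (simp add: vec_eq_iff ctranspose_nth)

lemma ctranspose_torus: "t \<in> torus \<Longrightarrow> ctranspose t \<in> torus"
  by (simp add: torus_def unitary_group_def ctranspose_ctranspose ctranspose_nth)

lemma p_part_in_pspace: "p_part A \<in> pspace"
  by (simp add: pspace_def p_part_def ctranspose_nth vec_eq_iff minus_divide_left)

lemma p_part_diagonal:
  assumes "\<forall>i j. i \<noteq> j \<longrightarrow> H $ i $ j = 0"
  shows "p_part H = 0"
  using assms by (auto simp: p_part_def vec_eq_iff)

text \<open>
  The form \<open>invariant_form (kaehler L J)\<close> on \<open>U(n)\<close> descends to \<open>F(n)\<close>: it vanishes on vectors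
  tangent to the fibres \<open>gT\<close> and is invariant under right translation by \<open>T\<close>.
\<close>

lemma kaehler_form_horizontal:
  assumes J: "invariant_acs J" and g: "g \<in> unitary_group"
    and H: "\<forall>i j. i \<noteq> j \<longrightarrow> H $ i $ j = 0"
  shows "invariant_form (kaehler L J) g (g ** H) Y = 0"
    and "invariant_form (kaehler L J) g Y (g ** H) = 0"
proof -
  have "0 = p_part (0 :: 'a cmat)"
    by (simp add: p_part_def vec_eq_iff)
  then have "(0 :: 'a cmat) \<in> pspace"
    using p_part_in_pspace by metis
  then have "J (0 *\<^sub>R 0) = 0 *\<^sub>R J 0"
    using J unfolding invariant_acs_def by blast
  then have J0: "J 0 = 0"
    by simp
  have "maurer_cartan g (g ** H) = H"
    using g by (simp add: maurer_cartan_def matrix_inv_unitary matrix_mul_assoc unitary_group_def)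
  then show "invariant_form (kaehler L J) g (g ** H) Y = 0"
    and "invariant_form (kaehler L J) g Y (g ** H) = 0"
    by (simp_all add: invariant_form_def p_part_diagonal[OF H] kaehler_def inv_metric_def J0)
qed

lemma kaehler_form_right_invariant:
  assumes J: "invariant_acs J" and g: "g \<in> unitary_group" and t: "t \<in> torus"
  shows "invariant_form (kaehler L J) (g ** t) (X ** t) (Y ** t) =
         invariant_form (kaehler L J) g X Y"
proof -
  have tu: "t \<in> unitary_group" using t by (simp add: torus_def)
  have c: "Ad (ctranspose t) A = ctranspose t ** A ** t" for A
    using ctranspose_torus[OF t] by (simp add: Ad_def matrix_inv_unitary torus_def ctranspose_ctranspose)
  have mc: "maurer_cartan (g ** t) (Z ** t) = ctranspose t ** maurer_cartan g Z ** t" for Z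
    by (simp add: maurer_cartan_def matrix_inv_unitary g tu unitary_mult ctranspose_mult
        matrix_mul_assoc)
  have p: "p_part (ctranspose t ** A ** t) = ctranspose t ** p_part A ** t" for A
    by (simp add: vec_eq_iff p_part_def diag_conj_nth[OF t] algebra_simps diff_divide_distrib)
  have m: "inv_metric L (ctranspose t ** A ** t) (ctranspose t ** B ** t) = inv_metric L A B" for A B
  proof -
    have "cnj (t $ i $ i) * a * t $ j $ j * cnj (cnj (t $ i $ i) * b * t $ j $ j) = a * cnj b"
      for i j a b
    proof -
      have "cnj (t $ i $ i) * a * t $ j $ j * cnj (cnj (t $ i $ i) * b * t $ j $ j) =
          (t $ i $ i * cnj (t $ i $ i)) * (t $ j $ j * cnj (t $ j $ j)) * (a * cnj b)"
        by simp
      then show ?thesis by (simp only: torus_diag_norm[OF t]) simp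
    qed
    then have "of_real r * (cnj (t $ i $ i) * a * t $ j $ j) *
        cnj (cnj (t $ i $ i) * b * t $ j $ j) = of_real r * a * cnj b" for r i j a b
      by (metis mult.assoc)
    then show ?thesis by (simp only: inv_metric_def diag_conj_nth[OF t])
  qed
  have "J (ctranspose t ** A ** t) = ctranspose t ** J A ** t" if "A \<in> pspace" for A
    using J ctranspose_torus[OF t] that c unfolding invariant_acs_def by metis
  then show ?thesis
    by (simp add: invariant_form_def mc p kaehler_def p_part_in_pspace m)
qed

text \<open>Exterior derivative of a 2-form on an open subset of a normed space.\<close>

definition ext_deriv2 ::
    "('a::real_normed_vector \<Rightarrow> 'a \<Rightarrow> 'a \<Rightarrow> complex) \<Rightarrow> 'a \<Rightarrow> 'a \<Rightarrow> 'a \<Rightarrow> 'a \<Rightarrow> complex" where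
  "ext_deriv2 b x X Y Z =
     frechet_derivative (\<lambda>y. b y Y Z) (at x) X
     - frechet_derivative (\<lambda>y. b y X Z) (at x) Y
     + frechet_derivative (\<lambda>y. b y X Y) (at x) Z"

text \<open>The value of \<open>d\<Omega>\<close> at \<open>gT\<close> on the tangent vectors \<open>d\<pi>\<^sub>g(gA)\<close>, \<open>d\<pi>\<^sub>g(gB)\<close>, \<open>d\<pi>\<^sub>g(gC)\<close>.\<close>

definition d_kaehler :: "real ^ 'n ^ 'n \<Rightarrow> ('n::finite cmat \<Rightarrow> 'n cmat) \<Rightarrow> 'n cmat \<Rightarrow>
    'n cmat \<Rightarrow> 'n cmat \<Rightarrow> 'n cmat \<Rightarrow> complex" where
  "d_kaehler L J g A B C =
     ext_deriv2 (invariant_form (kaehler L J)) g (g ** A) (g ** B) (g ** C)"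

text \<open>
  An element \<open>u + \<i>v\<close> of a complexified real vector space is written as the pair \<open>(u, v)\<close>.
  \<open>cextend\<close> is the complex trilinear extension of a complex-valued real trilinear form, and
  \<open>proj10\<close>, \<open>proj01\<close> are the projections \<open>(X \<mp> \<i>JX)/2\<close> of a real vector to the
  eigenspaces of \<open>J\<close> for \<open>\<i>\<close> and \<open>-\<i>\<close>.
\<close>

definition cextend :: "('a \<Rightarrow> 'a \<Rightarrow> 'a \<Rightarrow> complex) \<Rightarrow> 'a \<times> 'a \<Rightarrow> 'a \<times> 'a \<Rightarrow> 'a \<times> 'a \<Rightarrow> complex" where
  "cextend f X Y Z =
     f (fst X) (fst Y) (fst Z)
     + \<i> * (f (snd X) (fst Y) (fst Z) + f (fst X) (snd Y) (fst Z) + f (fst X) (fst Y) (snd Z))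
     - (f (snd X) (snd Y) (fst Z) + f (snd X) (fst Y) (snd Z) + f (fst X) (snd Y) (snd Z))
     - \<i> * f (snd X) (snd Y) (snd Z)"

definition proj10 :: "('a::real_vector \<Rightarrow> 'a) \<Rightarrow> 'a \<Rightarrow> 'a \<times> 'a" where
  "proj10 J X = ((1/2) *\<^sub>R X, - (1/2) *\<^sub>R J X)"

definition proj01 :: "('a::real_vector \<Rightarrow> 'a) \<Rightarrow> 'a \<Rightarrow> 'a \<times> 'a" where
  "proj01 J X = ((1/2) *\<^sub>R X, (1/2) *\<^sub>R J X)"

definition component12 ::
    "('a::real_vector \<Rightarrow> 'a) \<Rightarrow> ('a \<Rightarrow> 'a \<Rightarrow> 'a \<Rightarrow> complex) \<Rightarrow> 'a \<Rightarrow> 'a \<Rightarrow> 'a \<Rightarrow> complex" where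
  "component12 J f X Y Z =
     cextend f (proj10 J X) (proj01 J Y) (proj01 J Z)
     + cextend f (proj01 J X) (proj10 J Y) (proj01 J Z)
     + cextend f (proj01 J X) (proj01 J Y) (proj10 J Z)"

text \<open>\<open>x\<close> is a point of the flag manifold and \<open>g\<close> any of its representatives.\<close>

definition symplectic12 :: "real ^ 'n ^ 'n \<Rightarrow> ('n::finite cmat \<Rightarrow> 'n cmat) \<Rightarrow> bool" where
  "symplectic12 L J \<longleftrightarrow>
     (\<forall>x\<in>flag_manifold. \<forall>g\<in>x. \<forall>A\<in>pspace. \<forall>B\<in>pspace. \<forall>C\<in>pspace.
        component12 J (d_kaehler L J g) A B C = 0)"

end

theory Submission
  imports Defs
begin

text \<open>
  Write \<open>J A\<^sub>i\<^sub>j = \<i> \<epsilon>\<^sub>i\<^sub>j A\<^sub>i\<^sub>j\<close>, so that \<open>\<epsilon>\<^sub>i\<^sub>j = 1\<close> is the arc \<open>i \<rightarrow> j\<close>, and let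
  \<open>c\<^sub>i\<^sub>j = \<i> \<lambda>\<^sub>i\<^sub>j \<epsilon>\<^sub>i\<^sub>j\<close>; then \<open>\<Omega>(A, B) = \<Sum> c\<^sub>i\<^sub>j A\<^sub>i\<^sub>j B\<^sub>j\<^sub>i\<close>. Differentiating \<open>g\<^sup>-\<^sup>1\<close> gives
  \<open>d\<Omega>(A, B, C) = - \<Omega>([A, B], C) - \<Omega>([B, C], A) - \<Omega>([C, A], B)\<close>, whose coefficient at
  \<open>A\<^sub>i\<^sub>j B\<^sub>j\<^sub>k C\<^sub>k\<^sub>i\<close> is \<open>c\<^sub>i\<^sub>j + c\<^sub>j\<^sub>k + c\<^sub>k\<^sub>i\<close>. The \<open>(1,2)\<close>-part keeps the monomials in which exactly one
  of \<open>\<epsilon>\<^sub>i\<^sub>j, \<epsilon>\<^sub>j\<^sub>k, \<epsilon>\<^sub>k\<^sub>i\<close> is positive. Hence 3-cycles of the tournament impose nothing, while each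
  transitive triple \<open>a \<rightarrow> b \<rightarrow> c\<close>, \<open>a \<rightarrow> c\<close> imposes \<open>\<lambda>\<^sub>a\<^sub>c = \<lambda>\<^sub>a\<^sub>b + \<lambda>\<^sub>b\<^sub>c\<close>. For the given tournament these
  equations telescope to the two families of sums.
\<close>

section \<open>The derivative of matrix inversion\<close>

lemma bounded_bilinear_matrix_mult:
  "bounded_bilinear ((**) :: 'n::finite cmat \<Rightarrow> 'n cmat \<Rightarrow> 'n cmat)"
proof -
  have "bilinear ((**) :: 'n cmat \<Rightarrow> 'n cmat \<Rightarrow> 'n cmat)"
    unfolding bilinear_def
    by (auto intro!: linearI
        simp: vec_eq_iff matrix_matrix_mult_def sum.distrib algebra_simps scaleR_right.sum)
  then show ?thesis
    by (simp add: bilinear_conv_bounded_bilinear)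
qed

interpretation matrix_mult: bounded_bilinear "(**) :: 'n::finite cmat \<Rightarrow> 'n cmat \<Rightarrow> 'n cmat"
  by (rule bounded_bilinear_matrix_mult)

lemma matrix_inv_inverse:
  fixes A :: "'n::finite cmat"
  assumes "invertible A"
  shows "A ** matrix_inv A = mat 1" "matrix_inv A ** A = mat 1"
proof -
  obtain B where "A ** B = mat 1" "B ** A = mat 1"
    using assms by (auto simp: invertible_def)
  then show "A ** matrix_inv A = mat 1" "matrix_inv A ** A = mat 1"
    using matrix_inv_eqI by metis+
qed

text \<open>Invertibility is the condition \<open>det A \<noteq> 0\<close>, and \<open>det\<close>
  is continuous.\<close>

lemma eventually_invertible:
  fixes g :: "'n::finite cmat"
  assumes "invertible g"
  shows "eventually invertible (nhds g)"
proof -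
  have "continuous_on UNIV (det :: 'n cmat \<Rightarrow> complex)"
    unfolding det_def by (intro continuous_intros)
  then have "open {A :: 'n cmat. det A \<noteq> 0}"
    by (rule open_Collect_neq) (rule continuous_on_const)
  then have "open {A :: 'n cmat. invertible A}"
    by (simp add: invertible_det_nz)
  then show ?thesis
    using assms by (auto simp: eventually_nhds)
qed

text \<open>The resolvent identity. It serves both to bound inverses near \<open>g\<close> and to
  expand them to first order.\<close>

lemma matrix_inv_diff:
  fixes A B :: "'n::finite cmat"
  assumes "invertible A" "invertible B"
  shows "matrix_inv A - matrix_inv B = - (matrix_inv A ** (A - B) ** matrix_inv B)"
proof -
  have "matrix_inv A ** (A - B) ** matrix_inv B =
      (matrix_inv A ** A) ** matrix_inv B - matrix_inv A ** (B ** matrix_inv B)"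
    by (simp only: matrix_mult.diff_left matrix_mult.diff_right matrix_mul_assoc)
  then show ?thesis
    by (simp add: matrix_inv_inverse assms)
qed

text \<open>Using the resolvent identity twice leaves the remainder
  \<open>- ((matrix_inv y - G) ** (y - g) ** G)\<close>, quadratic in \<open>y - g\<close> once
  \<open>matrix_inv y\<close> is bounded near \<open>g\<close>. Each matrix product costs one factor
  \<open>K\<close> in the estimates.\<close>

lemma has_derivative_matrix_inv:
  fixes g :: "'n::finite cmat"
  assumes g: "invertible g"
  shows "(matrix_inv has_derivative (\<lambda>H. - (matrix_inv g ** H ** matrix_inv g))) (at g)"
proof -
  define G where "G = matrix_inv g"
  obtain K where K: "K > 0"
    and K_bound: "\<And>(A :: 'n cmat) (B :: 'n cmat). norm (A ** B) \<le> norm A * norm B * K"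
    using matrix_mult.pos_bounded by blast
  have norm3: "norm (A ** B ** C) \<le> norm A * norm B * norm C * K\<^sup>2" for A B C :: "'n cmat"
  proof -
    have "norm (A ** B ** C) \<le> norm (A ** B) * norm C * K"
      by (rule K_bound)
    also have "\<dots> \<le> (norm A * norm B * K) * norm C * K"
      using K K_bound by (intro mult_right_mono) auto
    finally show ?thesis
      by (simp add: power2_eq_square mult_ac)
  qed
  obtain d where d: "d > 0" "\<And>y. dist y g < d \<Longrightarrow> invertible y"
    using eventually_invertible[OF g] by (auto simp: eventually_nhds_metric)
  \<comment> \<open>The second bound forces \<open>norm (y - g) * norm G * K\<^sup>2\<close> to be
    at most 1/2, so the error term in the estimate of \<open>norm (matrix_inv y)\<close> can be
    absorbed on the left.\<close>
  define \<delta> where "\<delta> = min d (1 / (2 * K\<^sup>2 * (norm G + 1)))"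
  have den: "0 < 2 * K\<^sup>2 * (norm G + 1)"
    using K by (intro mult_pos_pos) (auto intro: add_nonneg_pos)
  have bound: "norm (matrix_inv y) \<le> 2 * norm G"
    if "dist y g < \<delta>" "invertible y" for y
  proof -
    have "norm (y - g) \<le> 1 / (2 * K\<^sup>2 * (norm G + 1))"
      using that by (simp add: \<delta>_def dist_norm)
    then have "norm (y - g) * (2 * K\<^sup>2 * (norm G + 1)) \<le> 1"
      using den by (simp add: pos_le_divide_eq)
    moreover have "norm (y - g) * (2 * K\<^sup>2 * norm G) \<le> norm (y - g) * (2 * K\<^sup>2 * (norm G + 1))"
      by (intro mult_left_mono) auto
    ultimately have "2 * (norm (y - g) * norm G * K\<^sup>2) \<le> 1"
      by (simp add: mult_ac)
    then have "norm (matrix_inv y) * (2 * (norm (y - g) * norm G * K\<^sup>2)) \<le> norm (matrix_inv y) * 1"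
      by (rule mult_left_mono) simp
    moreover have "norm (matrix_inv y) - norm G \<le> norm (matrix_inv y - G)"
      by (rule norm_triangle_ineq2)
    moreover have "norm (matrix_inv y - G) \<le> norm (matrix_inv y) * norm (y - g) * norm G * K\<^sup>2"
      using norm3[of "matrix_inv y" "y - g" G] matrix_inv_diff[OF \<open>invertible y\<close> g]
      by (simp add: G_def)
    ultimately show ?thesis
      by (simp add: mult_ac)
  qed
  have "bounded_linear (\<lambda>H. - (G ** H ** G))"
    by (intro bounded_linear_minus
        bounded_linear_compose[OF matrix_mult.bounded_linear_left matrix_mult.bounded_linear_right])
  then have "(matrix_inv has_derivative (\<lambda>H. - (G ** H ** G))) (at g)"
  proof (rule has_derivativeI_sandwich[where e = \<delta>
        and H = "\<lambda>y. 2 * norm G ^ 3 * K ^ 4 * norm (y - g)", rotated])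
    fix y assume y: "y \<noteq> g" "dist y g < \<delta>"
    then have inv: "invertible y"
      using d by (simp add: \<delta>_def)
    have "norm (matrix_inv y - G) \<le> norm (matrix_inv y) * norm (y - g) * norm G * K\<^sup>2"
      using norm3[of "matrix_inv y" "y - g" G] matrix_inv_diff[OF inv g]
      by (simp add: G_def)
    also have "\<dots> \<le> (2 * norm G) * norm (y - g) * norm G * K\<^sup>2"
      using bound[OF y(2) inv] by (intro mult_right_mono) auto
    finally have le: "norm (matrix_inv y - G) \<le> 2 * norm G * norm (y - g) * norm G * K\<^sup>2" .
    have "matrix_inv y - G - - (G ** (y - g) ** G) =
        - ((matrix_inv y - G) ** (y - g) ** G)"
    proof -
      have "matrix_inv y ** (y - g) ** G = - (matrix_inv y - G)"
        using matrix_inv_diff[OF inv g] by (simp add: G_def)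
      then show ?thesis
        by (simp only: matrix_mult.diff_left) simp
    qed
    then have "norm (matrix_inv y - G - - (G ** (y - g) ** G)) =
        norm ((matrix_inv y - G) ** (y - g) ** G)"
      by (simp only: norm_minus_cancel)
    also have "\<dots> \<le> norm (matrix_inv y - G) * norm (y - g) * norm G * K\<^sup>2"
      by (rule norm3)
    also have "\<dots> \<le> (2 * norm G * norm (y - g) * norm G * K\<^sup>2) * norm (y - g) * norm G * K\<^sup>2"
      using le by (intro mult_right_mono) auto
    finally show "norm (matrix_inv y - matrix_inv g - - (G ** (y - g) ** G)) / norm (y - g)
        \<le> 2 * norm G ^ 3 * K ^ 4 * norm (y - g)"
      using y unfolding G_def[symmetric] by (simp add: divide_le_eq power_numeral_reduce mult_ac)
  next
    show "((\<lambda>y. 2 * norm G ^ 3 * K ^ 4 * norm (y - g)) \<longlongrightarrow> 0) (at g)"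
      by (auto intro!: tendsto_eq_intros)
  next
    show "0 < \<delta>"
      using d den by (simp add: \<delta>_def)
  qed
  then show ?thesis
    by (simp add: G_def)
qed

lemma bounded_linear_p_part: "bounded_linear p_part"
  unfolding linear_conv_bounded_linear[symmetric]
  by (auto intro!: linearI simp: p_part_def vec_eq_iff complex_eq_iff algebra_simps
      add_divide_distrib diff_divide_distrib)

lemmas linear_p_part = bounded_linear.linear[OF bounded_linear_p_part]

text \<open>The vectors \<open>g ** Y\<close> and \<open>g ** Z\<close> stay constant while
  \<open>y\<close> moves, so only the inverse is differentiated. In direction \<open>g ** X\<close>
  each Maurer-Cartan factor contributes \<open>- (X ** W)\<close>, and the product rule gives the
  two terms.\<close>

lemma frechet_derivative_invariant_form:
  fixes b :: "'n::finite cmat \<Rightarrow> 'n cmat \<Rightarrow> complex"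
  assumes b: "bounded_bilinear b" and g: "invertible g"
  shows "frechet_derivative (\<lambda>y. invariant_form b y (g ** Y) (g ** Z)) (at g) (g ** X) =
    - (b (p_part Y) (p_part (X ** Z)) + b (p_part (X ** Y)) (p_part Z))"
proof -
  interpret b: bounded_bilinear b by fact
  define G where "G = matrix_inv g"
  have G: "G ** g = mat 1"
    using g by (simp add: G_def matrix_inv_inverse)
  have "((\<lambda>y. p_part (matrix_inv y ** W)) has_derivative
      (\<lambda>H. p_part (- (G ** H ** G) ** W))) (at g)" for W
    using has_derivative_matrix_inv[OF g] unfolding G_def
    by (intro bounded_linear.has_derivative[OF bounded_linear_p_part]
        bounded_linear.has_derivative[OF matrix_mult.bounded_linear_left])
  then have "((\<lambda>y. invariant_form b y (g ** Y) (g ** Z)) has_derivative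
      (\<lambda>H. b (p_part (G ** (g ** Y))) (p_part (- (G ** H ** G) ** (g ** Z))) +
           b (p_part (- (G ** H ** G) ** (g ** Y))) (p_part (G ** (g ** Z))))) (at g)"
    unfolding invariant_form_def maurer_cartan_def G_def by (intro b.FDERIV)
  note frechet_derivative_at[OF this, symmetric]
  moreover have "G ** (g ** W) = W" for W :: "'n cmat"
    by (simp add: matrix_mul_assoc G)
  moreover have "- (G ** (g ** X) ** G) ** (g ** W) = - (X ** W)" for W :: "'n cmat"
  proof -
    have "- (G ** (g ** X) ** G) ** (g ** W) = - ((G ** g) ** X ** (G ** g) ** W)"
      by (simp only: matrix_mult.minus_left matrix_mul_assoc)
    then show ?thesis by (simp add: G)
  qed
  ultimately show ?thesis
    by (simp add: linear_neg[OF linear_p_part] b.minus_left b.minus_right)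
qed

section \<open>Cyclic trilinear forms\<close>

text \<open>For constant \<open>d = 1\<close> this is the trace of \<open>X ** Y ** Z\<close>; the
  coefficients \<open>d\<close> break its cyclic symmetry in the way recorded by
  \<open>tri_cycle\<close>.\<close>

definition tri :: "('n \<Rightarrow> 'n \<Rightarrow> 'n \<Rightarrow> complex) \<Rightarrow> 'n::finite cmat \<Rightarrow> 'n cmat \<Rightarrow> 'n cmat \<Rightarrow> complex" where
  "tri d X Y Z = (\<Sum>i\<in>UNIV. \<Sum>j\<in>UNIV. \<Sum>k\<in>UNIV. d i j k * X $ i $ j * Y $ j $ k * Z $ k $ i)"

lemma tri_cycle: "tri d Y Z X = tri (\<lambda>i j k. d j k i) X Y Z"
proof -
  have "tri d Y Z X =
      (\<Sum>i\<in>UNIV. \<Sum>k\<in>UNIV. \<Sum>j\<in>UNIV. d i j k * Y $ i $ j * Z $ j $ k * X $ k $ i)"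
    unfolding tri_def by (intro sum.cong refl sum.swap)
  also have "\<dots> = (\<Sum>k\<in>UNIV. \<Sum>i\<in>UNIV. \<Sum>j\<in>UNIV. d i j k * Y $ i $ j * Z $ j $ k * X $ k $ i)"
    by (rule sum.swap)
  finally show ?thesis
    by (simp add: tri_def mult_ac)
qed

lemma tri_add: "tri (\<lambda>i j k. d i j k + d' i j k) X Y Z = tri d X Y Z + tri d' X Y Z"
  by (simp add: tri_def distrib_right sum.distrib)

lemma tri_minus: "tri (\<lambda>i j k. - d i j k) X Y Z = - tri d X Y Z"
  by (simp add: tri_def sum_negf)

section \<open>Complexification, and root vectors as test vectors\<close>

definition complexify :: "'n::finite cmat \<times> 'n cmat \<Rightarrow> 'n cmat" where
  "complexify U = (\<chi> i j. fst U $ i $ j + \<i> * snd U $ i $ j)"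

text \<open>\<open>tri d\<close> is already complex trilinear, so extending it amounts to evaluating
  it at the matrices \<open>u + iv\<close>. These represent the complexification faithfully on
  \<open>pspace\<close>, since skew-Hermitian matrices form a real form of all complex
  matrices.\<close>

lemma cextend_tri:
  "cextend (tri d) U V W = tri d (complexify U) (complexify V) (complexify W)"
  unfolding cextend_def tri_def complexify_def
  by (simp only: sum_distrib_left sum.distrib[symmetric] sum_subtractf[symmetric], intro sum.cong refl)
    (simp add: algebra_simps)

lemma cextend_swap: "cextend (\<lambda>X Y Z. f Y X Z) U V W = cextend f V U W"
  by (simp add: cextend_def)

lemma cextend_diff:
  "cextend (\<lambda>X Y Z. f X Y Z - h X Y Z) U V W = cextend f U V W - cextend h U V W"
  by (simp add: cextend_def algebra_simps)

lemma cextend_cong: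
  assumes "\<And>X Y Z. X \<in> S \<Longrightarrow> Y \<in> S \<Longrightarrow> Z \<in> S \<Longrightarrow> f X Y Z = h X Y Z"
    and "U \<in> S \<times> S" "V \<in> S \<times> S" "W \<in> S \<times> S"
  shows "cextend f U V W = cextend h U V W"
  using assms by (auto simp: cextend_def)

definition root_matrix :: "'n \<Rightarrow> 'n \<Rightarrow> 'n::finite cmat" where
  "root_matrix i j = (\<chi> a b. if a = i \<and> b = j then 1 else if a = j \<and> b = i then - 1 else 0)"

lemma root_matrix_pspace: "i \<noteq> j \<Longrightarrow> root_matrix i j \<in> pspace"
  by (auto simp: pspace_def root_matrix_def ctranspose_nth vec_eq_iff)

lemma root_matrix_swap: "i \<noteq> j \<Longrightarrow> root_matrix j i = - root_matrix i j"
  by (auto simp: root_matrix_def vec_eq_iff)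

text \<open>A nonzero monomial needs its first index in both {i, j} and {k, i}, and similarly for
  the others. For distinct indices one monomial survives, so single coefficients can be read
  off.\<close>

lemma tri_root_matrix:
  assumes "i \<noteq> j" "j \<noteq> k" "k \<noteq> i"
  shows "tri d (root_matrix i j) (root_matrix j k) (root_matrix k i) = d i j k"
proof -
  have "tri d (root_matrix i j) (root_matrix j k) (root_matrix k i) =
      (\<Sum>a\<in>UNIV. \<Sum>b\<in>UNIV. \<Sum>c\<in>UNIV. if c = k then if b = j then if a = i then d i j k else 0 else 0 else 0)"
    unfolding tri_def using assms
    by (intro sum.cong refl) (auto simp: root_matrix_def)
  then show ?thesis
    by simp
qed

text \<open>Exchanging two arguments traverses the triangle backwards; reversing the three root
  vectors yields the sign (-1)^3.\<close>

lemma tri_root_matrix_swap: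
  assumes "i \<noteq> j" "j \<noteq> k" "k \<noteq> i"
  shows "tri d (root_matrix j k) (root_matrix i j) (root_matrix k i) = - d k j i"
proof -
  have "tri d (root_matrix j k) (root_matrix i j) (root_matrix k i) =
      - tri d (root_matrix k j) (root_matrix j i) (root_matrix i k)"
    using root_matrix_swap[of k j] root_matrix_swap[of j i] root_matrix_swap[of i k] assms
    by (simp add: tri_def sum_negf)
  then show ?thesis
    using tri_root_matrix[of k j i d] assms by simp
qed

section \<open>The exterior derivative of the Kaehler form\<close>

lemma pspace_nth: "A \<in> pspace \<Longrightarrow> cnj (A $ i $ j) = - A $ j $ i"
  by (simp add: pspace_def vec_eq_iff ctranspose_nth)

lemma pspace_diag: "A \<in> pspace \<Longrightarrow> A $ i $ i = 0"
  by (simp add: pspace_def)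

lemma pspace_scaleR: "A \<in> pspace \<Longrightarrow> r *\<^sub>R A \<in> pspace"
  by (simp add: pspace_def vec_eq_iff ctranspose_nth)

lemma p_part_pspace: "A \<in> pspace \<Longrightarrow> p_part A = A"
  by (auto simp: p_part_def vec_eq_iff pspace_diag pspace_nth)

text \<open>The adjoint of \<open>A ** B\<close> is \<open>B ** A\<close> here, so the projection
  produces half the commutator with its diagonal deleted. This is how brackets enter.\<close>

lemma p_part_mult_nth:
  assumes "A \<in> pspace" "B \<in> pspace"
  shows "p_part (A ** B) $ i $ j =
    (if i = j then 0 else (\<Sum>k\<in>UNIV. A $ i $ k * B $ k $ j - B $ i $ k * A $ k $ j) / 2)"
  using assms
  by (simp add: p_part_def matrix_matrix_mult_def sum_subtractf pspace_nth mult.commute)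

lemma p_part_mult_swap:
  assumes "A \<in> pspace" "B \<in> pspace"
  shows "p_part (B ** A) = - p_part (A ** B)"
  using assms by (simp add: vec_eq_iff p_part_mult_nth sum_subtractf minus_divide_left)

text \<open>Any tournament is allowed here, with signs attached to matrix indices instead of
  players. Antisymmetry forces \<epsilon> to vanish on the diagonal, which is consistent because the
  entries of \<open>pspace\<close> vanish there.\<close>

locale signed_structure =
  fixes J :: "'n::finite cmat \<Rightarrow> 'n cmat" and L :: "real ^ 'n ^ 'n"
    and \<epsilon> :: "'n \<Rightarrow> 'n \<Rightarrow> real"
  assumes J_pspace: "A \<in> pspace \<Longrightarrow> J A \<in> pspace"
    and J_nth: "A \<in> pspace \<Longrightarrow> J A $ i $ j = \<i> * of_real (\<epsilon> i j) * A $ i $ j"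
    and sign_swap: "\<epsilon> j i = - \<epsilon> i j"
    and sign_cases: "i \<noteq> j \<Longrightarrow> \<epsilon> i j = 1 \<or> \<epsilon> i j = - 1"
    and L_sym: "L $ i $ j = L $ j $ i"
begin

definition weight :: "'n \<Rightarrow> 'n \<Rightarrow> complex" where
  "weight i j = \<i> * of_real (L $ i $ j * \<epsilon> i j)"

text \<open>This expression is bilinear on all matrices, whereas \<open>kaehler L J\<close> inherits
  the arbitrary values of \<open>J\<close> outside \<open>pspace\<close>.\<close>

definition form :: "'n cmat \<Rightarrow> 'n cmat \<Rightarrow> complex" where
  "form A B = (\<Sum>i\<in>UNIV. \<Sum>j\<in>UNIV. weight i j * A $ i $ j * B $ j $ i)"

definition defect :: "'n \<Rightarrow> 'n \<Rightarrow> 'n \<Rightarrow> complex" where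
  "defect i j k = weight i j + weight j k + weight k i"

text \<open>For signs \<open>\<plusminus>1\<close> this is the indicator of exactly one of \<open>\<epsilon> i j, \<epsilon> j k, \<epsilon> k i\<close> being \<open>1\<close>.\<close>

definition type12 :: "'n \<Rightarrow> 'n \<Rightarrow> 'n \<Rightarrow> complex" where
  "type12 i j k = of_real (
     (1 + \<epsilon> i j) / 2 * ((1 - \<epsilon> j k) / 2) * ((1 - \<epsilon> k i) / 2) +
     (1 - \<epsilon> i j) / 2 * ((1 + \<epsilon> j k) / 2) * ((1 - \<epsilon> k i) / 2) +
     (1 - \<epsilon> i j) / 2 * ((1 - \<epsilon> j k) / 2) * ((1 + \<epsilon> k i) / 2))"

lemma sign_diag: "\<epsilon> i i = 0"
  using sign_swap[of i i] by simp

lemma weight_swap: "weight j i = - weight i j"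
  using L_sym[of i j] sign_swap[of j i] by (simp add: weight_def)

lemma weight_diag: "weight i i = 0"
  by (simp add: weight_def sign_diag)

lemma kaehler_eq_form:
  assumes "A \<in> pspace" "B \<in> pspace"
  shows "kaehler L J A B = form A B"
  unfolding kaehler_def inv_metric_def form_def
proof (intro sum.cong refl)
  fix i j
  have "cnj (J B $ i $ j) = - J B $ j $ i"
    using J_pspace assms by (simp add: pspace_nth)
  also have "\<dots> = \<i> * of_real (\<epsilon> i j) * B $ j $ i"
    using J_nth[OF assms(2), of j i] sign_swap[of j i] by simp
  finally show "of_real (L $ i $ j) * A $ i $ j * cnj (J B $ i $ j) =
      weight i j * A $ i $ j * B $ j $ i"
    by (simp add: weight_def)
qed

text \<open>\<open>p_part\<close> always lands in \<open>pspace\<close>, where both forms agree. The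
  equality holds at every base point, so it may be used under the derivative.\<close>

lemma invariant_form_kaehler: "invariant_form (kaehler L J) = invariant_form form"
  by (simp add: fun_eq_iff invariant_form_def kaehler_eq_form p_part_in_pspace)

lemma form_bounded_bilinear: "bounded_bilinear form"
proof -
  have "bilinear form"
    unfolding bilinear_def form_def
    by (auto intro!: linearI simp: sum.distrib algebra_simps scaleR_right.sum)
  then show ?thesis
    by (simp add: bilinear_conv_bounded_bilinear)
qed

lemma form_swap: "form B A = - form A B"
proof -
  have "form B A = (\<Sum>j\<in>UNIV. \<Sum>i\<in>UNIV. weight i j * B $ i $ j * A $ j $ i)"
    unfolding form_def by (rule sum.swap)
  also have "\<dots> = (\<Sum>j\<in>UNIV. \<Sum>i\<in>UNIV. - (weight j i * A $ j $ i * B $ i $ j))"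
    by (intro sum.cong refl, subst weight_swap) (simp add: mult_ac)
  finally show ?thesis
    by (simp add: form_def sum_negf)
qed

text \<open>The summation index of the matrix product becomes the middle index of
  \<open>tri\<close>, so the weight joins the first and third indices. The factor 2 cancels the half
  in \<open>p_part\<close>, and the deleted diagonal is harmless because
  \<open>weight i i = 0\<close>.\<close>

lemma form_bracket:
  assumes "A \<in> pspace" "B \<in> pspace"
  shows "2 * form (p_part (A ** B)) C =
    tri (\<lambda>i j k. weight i k) A B C - tri (\<lambda>i j k. weight i k) B A C"
proof -
  have "2 * form (p_part (A ** B)) C = (\<Sum>i\<in>UNIV. \<Sum>j\<in>UNIV. \<Sum>k\<in>UNIV.
      weight i j * A $ i $ k * B $ k $ j * C $ j $ i - weight i j * B $ i $ k * A $ k $ j * C $ j $ i)"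
    unfolding form_def sum_distrib_left
  proof (intro sum.cong refl)
    fix i j
    show "2 * (weight i j * p_part (A ** B) $ i $ j * C $ j $ i) = (\<Sum>k\<in>UNIV.
      weight i j * A $ i $ k * B $ k $ j * C $ j $ i - weight i j * B $ i $ k * A $ k $ j * C $ j $ i)"
      using assms
      by (simp add: p_part_mult_nth weight_diag sum_distrib_left sum_distrib_right algebra_simps)
  qed
  also have "\<dots> = (\<Sum>i\<in>UNIV. \<Sum>k\<in>UNIV. \<Sum>j\<in>UNIV.
      weight i j * A $ i $ k * B $ k $ j * C $ j $ i - weight i j * B $ i $ k * A $ k $ j * C $ j $ i)"
    by (intro sum.cong refl sum.swap)
  finally show ?thesis
    by (simp add: tri_def sum_subtractf)
qed

lemma d_kaehler_eq:
  assumes g: "g \<in> unitary_group" and p: "A \<in> pspace" "B \<in> pspace" "C \<in> pspace"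
  shows "d_kaehler L J g A B C = tri defect A B C - tri defect B A C"
proof -
  interpret form: bounded_bilinear form
    by (rule form_bounded_bilinear)
  define t where "t = tri (\<lambda>i j k. weight i k)"
  have "invertible g"
    using g by (auto simp: invertible_def unitary_group_def)
  note e = frechet_derivative_invariant_form[OF form_bounded_bilinear this]
  have cyclic_sum: "t X Y Z + t Y Z X + t Z X Y = - tri defect X Y Z" for X Y Z
  proof -
    have "t X Y Z + t Y Z X + t Z X Y = tri (\<lambda>i j k. weight i k + weight j i + weight k j) X Y Z"
      using tri_cycle[of "\<lambda>i j k. weight i k" Y Z X] tri_cycle[of "\<lambda>i j k. weight j i" Y Z X]
        tri_cycle[of "\<lambda>i j k. weight i k" Z X Y]
      by (simp add: t_def tri_add)
    also have "(\<lambda>i j k. weight i k + weight j i + weight k j) = (\<lambda>i j k. - defect i j k)"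
    proof (intro ext)
      fix i j k
      show "weight i k + weight j i + weight k j = - defect i j k"
        using weight_swap[of i k] weight_swap[of j i] weight_swap[of k j] by (simp add: defect_def)
    qed
    finally show ?thesis
      by (simp add: tri_minus)
  qed
  \<comment> \<open>The three derivatives give six terms; antisymmetry of \<open>form\<close> and of
    \<open>p_part (A ** B)\<close> pairs them into three doubled brackets.\<close>
  have "d_kaehler L J g A B C =
      - (2 * form (p_part (A ** B)) C + 2 * form (p_part (B ** C)) A + 2 * form (p_part (C ** A)) B)"
    using p form_swap[of B "p_part (A ** C)"] form_swap[of A "p_part (B ** C)"]
      form_swap[of A "p_part (C ** B)"]
      p_part_mult_swap[of A B] p_part_mult_swap[of B C] p_part_mult_swap[of C A]
    by (simp add: d_kaehler_def ext_deriv2_def invariant_form_kaehler e p_part_pspace form.minus_left)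
  also have "\<dots> = - (t A B C - t B A C + (t B C A - t C B A) + (t C A B - t A C B))"
    using p by (simp only: form_bracket t_def)
  also have "\<dots> = - (t A B C + t B C A + t C A B) + (t B A C + t A C B + t C B A)"
    by simp
  finally show ?thesis
    using cyclic_sum[of A B C] cyclic_sum[of B A C] by simp
qed

text \<open>The entries are eigencoordinates of \<open>J\<close>, so off the diagonal the
  projections keep or kill each entry, according to its sign.\<close>

lemma complexify_proj:
  assumes "A \<in> pspace"
  shows "complexify (proj10 J A) $ i $ j = of_real ((1 + \<epsilon> i j) / 2) * A $ i $ j"
    and "complexify (proj01 J A) $ i $ j = of_real ((1 - \<epsilon> i j) / 2) * A $ i $ j"
  using J_nth[OF assms, of i j]
  by (simp_all add: complexify_def proj10_def proj01_def scaleR_conv_of_real[where 'a = complex]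
      field_simps)

lemma component12_eq:
  assumes g: "g \<in> unitary_group" and p: "A \<in> pspace" "B \<in> pspace" "C \<in> pspace"
  shows "component12 J (d_kaehler L J g) A B C =
    tri (\<lambda>i j k. defect i j k * type12 i j k) A B C -
    tri (\<lambda>i j k. defect i j k * type12 i j k) B A C"
proof -
  have cext: "cextend (d_kaehler L J g) U V W =
      tri defect (complexify U) (complexify V) (complexify W) -
      tri defect (complexify V) (complexify U) (complexify W)"
    if "U \<in> pspace \<times> pspace" "V \<in> pspace \<times> pspace" "W \<in> pspace \<times> pspace" for U V W
  proof -
    have "cextend (d_kaehler L J g) U V W =
        cextend (\<lambda>X Y Z. tri defect X Y Z - tri defect Y X Z) U V W"
      using d_kaehler_eq[OF g] that by (rule cextend_cong)
    then show ?thesis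
      by (simp only: cextend_diff cextend_swap[of "tri defect"] cextend_tri)
  qed
  have proj: "proj10 J X \<in> pspace \<times> pspace" "proj01 J X \<in> pspace \<times> pspace"
    if "X \<in> pspace" for X
    using that J_pspace pspace_scaleR[of _ "- 1 / 2"] pspace_scaleR[of _ "1 / 2"]
    by (auto simp: proj10_def proj01_def)
  \<comment> \<open>The position of the argument of type (1,0) selects one of the three summands of
    \<open>type12\<close>.\<close>
  have "tri defect (complexify (proj10 J X)) (complexify (proj01 J Y)) (complexify (proj01 J Z)) +
     tri defect (complexify (proj01 J X)) (complexify (proj10 J Y)) (complexify (proj01 J Z)) +
     tri defect (complexify (proj01 J X)) (complexify (proj01 J Y)) (complexify (proj10 J Z)) =
     tri (\<lambda>i j k. defect i j k * type12 i j k) X Y Z"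
    if "X \<in> pspace" "Y \<in> pspace" "Z \<in> pspace" for X Y Z
    unfolding tri_def complexify_proj[OF that(1)] complexify_proj[OF that(2)] complexify_proj[OF that(3)]
      type12_def sum.distrib[symmetric]
    by (intro sum.cong refl) (simp only: of_real_add of_real_mult distrib_left distrib_right mult_ac)
  from this[OF p] this[OF p(2,1,3)] show ?thesis
    unfolding component12_def by (simp only: cext proj p) (simp add: algebra_simps)
qed

lemma defect_transitive:
  assumes "\<epsilon> a b = 1" "\<epsilon> b c = 1" "\<epsilon> a c = 1"
  shows "defect a b c = \<i> * of_real (L $ a $ b + L $ b $ c - L $ a $ c)"
  using assms sign_swap[of c a] L_sym[of a c] by (simp add: defect_def weight_def algebra_simps)

lemma defect_swap: "defect k j i = - defect i j k"
  using weight_swap[of i j] weight_swap[of j k] weight_swap[of k i] by (simp add: defect_def)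

text \<open>By \<open>component12_eq\<close> the value is independent of \<open>g\<close>, so
  necessity is tested at the identity on root vectors and sufficiency is checked coefficient by
  coefficient.\<close>

lemma symplectic12_iff:
  "symplectic12 L J \<longleftrightarrow>
    (\<forall>a b c. \<epsilon> a b = 1 \<and> \<epsilon> b c = 1 \<and> \<epsilon> a c = 1 \<longrightarrow> L $ a $ c = L $ a $ b + L $ b $ c)"
proof
  assume symp: "symplectic12 L J"
  show "\<forall>a b c. \<epsilon> a b = 1 \<and> \<epsilon> b c = 1 \<and> \<epsilon> a c = 1 \<longrightarrow> L $ a $ c = L $ a $ b + L $ b $ c"
  proof (intro allI impI)
    fix a b c assume abc: "\<epsilon> a b = 1 \<and> \<epsilon> b c = 1 \<and> \<epsilon> a c = 1"
    then have ne: "a \<noteq> b" "b \<noteq> c" "c \<noteq> a"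
      by (auto simp: sign_diag)
    have one: "mat 1 \<in> (unitary_group :: 'n cmat set)"
      by (simp add: unitary_group_def ctranspose_def transpose_mat vec_eq_iff mat_def transpose_def
          matrix_matrix_mult_def if_distrib[of cnj] if_distrib[of "\<lambda>x. x * _"] cong: if_cong)
    then have "mat 1 \<in> (torus :: 'n cmat set)"
      by (simp add: torus_def mat_def)
    then have "mat 1 \<in> (\<lambda>t. mat 1 ** t) ` (torus :: 'n cmat set)"
      by simp
    moreover have "(\<lambda>t. mat 1 ** t) ` (torus :: 'n cmat set) \<in> flag_manifold"
      using one by (auto simp only: flag_manifold_def)
    ultimately have "component12 J (d_kaehler L J (mat 1)) (root_matrix a b) (root_matrix b c)
        (root_matrix c a) = 0"
      using symp root_matrix_pspace[OF ne(1)] root_matrix_pspace[OF ne(2)] root_matrix_pspace[OF ne(3)]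
      unfolding symplectic12_def by blast
    then have "defect a b c * type12 a b c + defect c b a * type12 c b a = 0"
      using ne by (simp add: component12_eq one root_matrix_pspace tri_root_matrix tri_root_matrix_swap)
    \<comment> \<open>Around \<open>a\<close>, \<open>b\<close>, \<open>c\<close> two signs are
      positive, around the reversed cycle only one, so only the reversed coefficient
      survives.\<close>
    moreover have "type12 a b c = 0" "type12 c b a = 1"
      using abc sign_swap[of a b] sign_swap[of b c] sign_swap[of a c] by (simp_all add: type12_def)
    ultimately have "defect a b c = 0"
      using defect_swap[of c b a] by simp
    then have "of_real (L $ a $ b + L $ b $ c - L $ a $ c) = (0 :: complex)"
      using abc by (simp add: defect_transitive del: of_real_add of_real_diff)
    then have "L $ a $ b + L $ b $ c - L $ a $ c = 0"
      by (simp only: of_real_eq_0_iff)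
    then show "L $ a $ c = L $ a $ b + L $ b $ c"
      by simp
  qed
next
  assume trans: "\<forall>a b c. \<epsilon> a b = 1 \<and> \<epsilon> b c = 1 \<and> \<epsilon> a c = 1 \<longrightarrow> L $ a $ c = L $ a $ b + L $ b $ c"
  have zero: "defect a b c = 0" if "\<epsilon> a b = 1" "\<epsilon> b c = 1" "\<epsilon> a c = 1" for a b c
    using trans that by (simp add: defect_transitive)
  have cyc: "defect b c a = defect a b c" for a b c
    by (simp add: defect_def)
  have "defect i j k * type12 i j k = 0" for i j k
  proof (cases "i = j \<or> j = k \<or> k = i")
    case True
    then show ?thesis
      using weight_swap[of i j] weight_swap[of j k] by (auto simp: defect_def weight_diag)
  next
    case False
    then have "\<epsilon> i j = 1 \<or> \<epsilon> i j = - 1" "\<epsilon> j k = 1 \<or> \<epsilon> j k = - 1" "\<epsilon> k i = 1 \<or> \<epsilon> k i = - 1"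
      using sign_cases by auto
    \<comment> \<open>If exactly one sign is positive, its arc runs from the source to the sink of a
      transitive triple; the three cases say which arc that is.\<close>
    then have "type12 i j k = 0 \<or> \<epsilon> i k = 1 \<and> \<epsilon> k j = 1 \<and> \<epsilon> i j = 1 \<or>
        \<epsilon> j i = 1 \<and> \<epsilon> i k = 1 \<and> \<epsilon> j k = 1 \<or> \<epsilon> k j = 1 \<and> \<epsilon> j i = 1 \<and> \<epsilon> k i = 1"
      using sign_swap[of i j] sign_swap[of j k] sign_swap[of k i]
      by (elim disjE) (simp_all add: type12_def)
    then consider "type12 i j k = 0"
      | "\<epsilon> i k = 1" "\<epsilon> k j = 1" "\<epsilon> i j = 1"
      | "\<epsilon> j i = 1" "\<epsilon> i k = 1" "\<epsilon> j k = 1"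
      | "\<epsilon> k j = 1" "\<epsilon> j i = 1" "\<epsilon> k i = 1"
      by blast
    then show ?thesis
    proof cases
      case 2
      then show ?thesis
        using zero[of i k j] cyc[of j k i] defect_swap[of j k i] by simp
    next
      case 3
      then show ?thesis
        using zero[of j i k] cyc[of j k i] cyc[of k i j] defect_swap[of k i j] by simp
    next
      case 4
      then show ?thesis
        using zero[of k j i] defect_swap[of i j k] by simp
    qed simp
  qed
  then have "tri (\<lambda>i j k. defect i j k * type12 i j k) X Y Z = 0" for X Y Z
    by (simp only: tri_def mult_zero_left sum.neutral_const)
  moreover have "g \<in> unitary_group" if "x \<in> flag_manifold" "g \<in> x" for x and g :: "'n cmat"
    using that by (auto simp: flag_manifold_def torus_def intro: unitary_mult)
  ultimately show "symplectic12 L J"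
    by (simp add: symplectic12_def component12_eq)
qed

end

section \<open>The tournament of the theorem\<close>

text \<open>The prescribed tournament on {1..n}; the conjunct \<open>b < n\<close> keeps the
  relation irreflexive for every \<open>k\<close>.\<close>

definition wins :: "nat \<Rightarrow> nat \<Rightarrow> nat \<Rightarrow> nat \<Rightarrow> bool" where
  "wins n k a b \<longleftrightarrow> a < b \<and> (b \<noteq> n \<or> k < a) \<or> a = n \<and> b < n \<and> b \<le> k"

text \<open>Triples of increasing players telescope to the first family. Triples starting at
  \<open>n\<close> continue inside {1..k}, and those through player 1 determine the second
  family.\<close>

lemma transitive_triples_iff_sums:
  fixes l :: "nat \<Rightarrow> nat \<Rightarrow> real"
  assumes k: "1 \<le> k" "k < n" and sym: "\<And>i j. l i j = l j i"
  shows "(\<forall>a\<in>{1..n}. \<forall>b\<in>{1..n}. \<forall>c\<in>{1..n}.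
      wins n k a b \<and> wins n k b c \<and> wins n k a c \<longrightarrow> l a c = l a b + l b c) \<longleftrightarrow>
    (\<forall>i j. 1 \<le> i \<and> i < j \<and> j \<le> n \<and> \<not> (j = n \<and> i \<le> k) \<longrightarrow> l i j = (\<Sum>m=i..<j. l m (m + 1))) \<and>
    (\<forall>i. 2 \<le> i \<and> i \<le> k \<longrightarrow> l i n = (\<Sum>m=1..<i. l m (m + 1)) + l 1 n)"
  (is "?T \<longleftrightarrow> ?S1 \<and> ?S2")
proof
  assume T: ?T
  have S1: "l i j = (\<Sum>m=i..<j. l m (m + 1))"
    if "i < j" "1 \<le> i" "j \<le> n" "j \<noteq> n \<or> k < i" for i j
    using that
  proof (induction j rule: nat_induct)
    case (Suc j)
    show ?case
    proof (cases "j = i")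
      case False
      then have j: "i < j" "1 \<le> j" "j < n" "Suc j \<noteq> n \<or> k < i"
        using Suc.prems by auto
      \<comment> \<open>Only the last step is split off. When \<open>Suc j = n\<close>, the
        hypothesis \<open>k < i\<close> passes to \<open>j\<close>, which gives the arc from
        \<open>j\<close> to \<open>n\<close>.\<close>
      then have "wins n k i j \<and> wins n k j (Suc j) \<and> wins n k i (Suc j)"
        by (auto simp: wins_def)
      then have "l i (Suc j) = l i j + l j (Suc j)"
        using T Suc.prems j by simp
      then show ?thesis
        using Suc.IH j Suc.prems by simp
    qed simp
  qed simp
  have S2: "l i n = (\<Sum>m=1..<i. l m (m + 1)) + l 1 n" if "2 \<le> i" "i \<le> k" for i
  proof -
    have "wins n k n 1 \<and> wins n k 1 i \<and> wins n k n i"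
      using that k by (auto simp: wins_def)
    then have "l n i = l n 1 + l 1 i"
      using T that k by simp
    moreover have "l 1 i = (\<Sum>m=1..<i. l m (m + 1))"
      using that k by (intro S1) auto
    ultimately show ?thesis
      using sym[of n i] sym[of n 1] by simp
  qed
  show "?S1 \<and> ?S2"
  proof (intro conjI allI impI)
    fix i j assume "1 \<le> i \<and> i < j \<and> j \<le> n \<and> \<not> (j = n \<and> i \<le> k)"
    then show "l i j = (\<Sum>m=i..<j. l m (m + 1))"
      by (intro S1) auto
  next
    fix i assume "2 \<le> i \<and> i \<le> k"
    then show "l i n = (\<Sum>m=1..<i. l m (m + 1)) + l 1 n"
      by (intro S2) auto
  qed
next
  assume S: "?S1 \<and> ?S2"
  have S1: "l i j = (\<Sum>m=i..<j. l m (m + 1))"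
    if "i < j" "1 \<le> i" "j \<le> n" "j \<noteq> n \<or> k < i" for i j
  proof -
    have "1 \<le> i \<and> i < j \<and> j \<le> n \<and> \<not> (j = n \<and> i \<le> k)"
      using that by auto
    with S show ?thesis
      by blast
  qed
  \<comment> \<open>The range now includes \<open>i = 1\<close>, where the sum is empty and the
    claim is symmetry.\<close>
  have S2: "l n i = (\<Sum>m=1..<i. l m (m + 1)) + l 1 n" if "1 \<le> i" "i \<le> k" for i
  proof (cases "i = 1")
    case True
    then show ?thesis using sym[of n 1] by simp
  next
    case False
    then have "l i n = (\<Sum>m=1..<i. l m (m + 1)) + l 1 n"
    proof -
      have "2 \<le> i \<and> i \<le> k"
        using False that by auto
      with S show ?thesis
        by blast
    qed
    then show ?thesis using sym[of n i] by simp
  qed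
  have cat: "(\<Sum>m=a..<b. l m (m + 1)) + (\<Sum>m=b..<c. l m (m + 1)) = (\<Sum>m=a..<c. l m (m + 1))"
    if "a < b" "b < c" for a b c
    using that by (intro sum.atLeastLessThan_concat) auto
  show ?T
  proof (intro ballI impI)
    fix a b c assume in_range: "a \<in> {1..n}" "b \<in> {1..n}" "c \<in> {1..n}"
      and arcs: "wins n k a b \<and> wins n k b c \<and> wins n k a c"
    show "l a c = l a b + l b c"
    proof (cases "a = n")
      case True
      then have "b < c" "b \<le> k" "c \<le> k"
        using arcs in_range by (auto simp: wins_def)
      then have "l n b = (\<Sum>m=1..<b. l m (m + 1)) + l 1 n"
        "l n c = (\<Sum>m=1..<c. l m (m + 1)) + l 1 n" "l b c = (\<Sum>m=b..<c. l m (m + 1))"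
        using in_range k S2[of b] S2[of c] S1[of b c] by simp_all
      then show ?thesis
        using True \<open>b < c\<close> in_range sum.atLeastLessThan_concat[of 1 b c "\<lambda>m. l m (m + 1)"] by simp
    next
      case False
      then have "a < b" "b \<noteq> n \<or> k < a" "a < c" "c \<noteq> n \<or> k < a"
        using arcs by (auto simp: wins_def)
      \<comment> \<open>The middle player cannot be \<open>n\<close>: that would give
        \<open>c \<le> k\<close> and \<open>k < a\<close>, against \<open>a < c\<close>.\<close>
      moreover have "b < c" "c \<noteq> n \<or> k < b"
        using arcs False calculation by (auto simp: wins_def)
      ultimately have "l a b = (\<Sum>m=a..<b. l m (m + 1))" "l b c = (\<Sum>m=b..<c. l m (m + 1))"
        "l a c = (\<Sum>m=a..<c. l m (m + 1))"
        using in_range S1[of a b] S1[of b c] S1[of a c] by auto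
      then show ?thesis
        using cat \<open>a < b\<close> \<open>b < c\<close> by simp
    qed
  qed
qed

section \<open>Passage from matrix indices to players\<close>

theorem theorem3p1:
  fixes e :: "nat \<Rightarrow> 'n::finite" and n k :: nat
    and J :: "'n cmat \<Rightarrow> 'n cmat" and L :: "real ^ 'n ^ 'n"
  assumes "bij_betw e {1..n} (UNIV :: 'n set)"
    and "4 \<le> n" and "1 \<le> k" and "k + 3 \<le> n"
    and "invariant_acs J"
    and "\<And>i. 1 \<le> i \<Longrightarrow> i \<le> k \<Longrightarrow> beats e J n i"
    and "\<And>i j. 1 \<le> i \<Longrightarrow> i < j \<Longrightarrow> j \<le> n \<Longrightarrow> j \<noteq> n \<or> k < i \<Longrightarrow> beats e J i j"
    and "metric_matrix L"
  shows "symplectic12 L J \<longleftrightarrow>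
    (\<forall>i j. 1 \<le> i \<and> i < j \<and> j \<le> n \<and> \<not> (j = n \<and> i \<le> k) \<longrightarrow>
       L $ e i $ e j = (\<Sum>l=i..<j. L $ e l $ e (l + 1))) \<and>
    (\<forall>i. 2 \<le> i \<and> i \<le> k \<longrightarrow>
       L $ e i $ e n = (\<Sum>l=1..<i. L $ e l $ e (l + 1)) + L $ e 1 $ e n)"
proof -
  define f where "f = the_inv_into {1..n} e"
  have inj: "inj_on e {1..n}" and img: "e ` {1..n} = UNIV"
    using assms(1) by (auto simp: bij_betw_def)
  have f_in: "f x \<in> {1..n}" and e_f: "e (f x) = x" for x
    using the_inv_into_into[OF inj, of x "{1..n}"] f_the_inv_into_f[OF inj, of x] img
    by (auto simp: f_def)
  have f_e: "f (e i) = i" if "i \<in> {1..n}" for i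
    using the_inv_into_f_f[OF inj that] by (simp add: f_def)
  have f_eq: "f x = f y \<longleftrightarrow> x = y" for x y
    using e_f by metis
  define \<epsilon> :: "'n \<Rightarrow> 'n \<Rightarrow> real"
    where "\<epsilon> x y = (if x = y then 0 else if wins n k (f x) (f y) then 1 else - 1)" for x y
  have J_pspace: "J A \<in> pspace" if "A \<in> pspace" for A
    using assms(5) that by (simp add: invariant_acs_def)
  have wins_swap: "wins n k b a \<longleftrightarrow> \<not> wins n k a b" if "a \<noteq> b" "a \<in> {1..n}" "b \<in> {1..n}" for a b
    using that by (auto simp: wins_def)
  \<comment> \<open>\<open>beats\<close> fixes only the entry whose smaller player comes first;
    skew-Hermitian symmetry turns this into the opposite factor at the transposed entry.\<close>
  have J_swap: "J A $ y $ x = - \<i> * A $ y $ x" if "A \<in> pspace" "J A $ x $ y = \<i> * A $ x $ y" for A x y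
    using pspace_nth[OF J_pspace[OF that(1)], of x y] pspace_nth[OF that(1), of x y] that(2) by simp
  have J_swap': "J A $ y $ x = \<i> * A $ y $ x" if "A \<in> pspace" "J A $ x $ y = - \<i> * A $ x $ y" for A x y
    using pspace_nth[OF J_pspace[OF that(1)], of x y] pspace_nth[OF that(1), of x y] that(2) by simp
  have J_wins: "J A $ e a $ e b = \<i> * A $ e a $ e b"
    if A: "A \<in> pspace" and ab: "a \<in> {1..n}" "b \<in> {1..n}" "wins n k a b" for A a b
  proof -
    \<comment> \<open>For the arcs from \<open>n\<close> to players up to \<open>k\<close>,
      \<open>beats\<close> speaks of the transposed entry, hence the use of \<open>J_swap'\<close>
      afterwards.\<close>
    have "beats e J a b"
      using assms(6,7) ab by (auto simp: wins_def)
    then show ?thesis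
      using A J_swap' by (auto simp: beats_def)
  qed
  interpret signed_structure J L \<epsilon>
  proof
    fix A :: "'n cmat" and x y assume A: "A \<in> pspace"
    consider "x = y" | "x \<noteq> y" "wins n k (f x) (f y)" | "x \<noteq> y" "\<not> wins n k (f x) (f y)" "wins n k (f y) (f x)"
      using wins_swap[of "f x" "f y"] f_in f_eq by blast
    then show "J A $ x $ y = \<i> * of_real (\<epsilon> x y) * A $ x $ y"
    proof cases
      case 1
      then show ?thesis
        using A J_pspace by (simp add: \<epsilon>_def pspace_diag)
    next
      case 2
      then show ?thesis
        using J_wins[OF A f_in f_in] by (simp add: \<epsilon>_def e_f)
    next
      case 3
      then show ?thesis
        using J_swap[OF A] J_wins[OF A f_in f_in, of y x] by (simp add: \<epsilon>_def e_f)
    qed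
  next
    fix x y
    show "\<epsilon> y x = - \<epsilon> x y"
      using wins_swap[of "f x" "f y"] f_in f_eq by (auto simp: \<epsilon>_def)
    show "x \<noteq> y \<Longrightarrow> \<epsilon> x y = 1 \<or> \<epsilon> x y = - 1"
      by (auto simp: \<epsilon>_def)
    show "L $ x $ y = L $ y $ x"
      using assms(8) by (simp add: metric_matrix_def)
  qed (rule J_pspace)
  have all_e: "(\<forall>x. P x) \<longleftrightarrow> (\<forall>a\<in>{1..n}. P (e a))" for P
  proof -
    have "(\<forall>x. P x) \<longleftrightarrow> (\<forall>x\<in>e ` {1..n}. P x)"
      by (simp only: img ball_UNIV)
    then show ?thesis
      by (simp only: ball_simps)
  qed
  have wins_irrefl: "\<not> wins n k a a" for a
    by (auto simp: wins_def)
  have e_eq: "e a = e b \<longleftrightarrow> a = b" if "a \<in> {1..n}" "b \<in> {1..n}" for a b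
    using inj_on_eq_iff[OF inj that] .
  have \<epsilon>_e: "\<epsilon> (e a) (e b) = 1 \<longleftrightarrow> wins n k a b" if "a \<in> {1..n}" "b \<in> {1..n}" for a b
    using wins_irrefl by (auto simp: \<epsilon>_def e_eq[OF that] f_e[OF that(1)] f_e[OF that(2)])
  have "symplectic12 L J \<longleftrightarrow> (\<forall>a\<in>{1..n}. \<forall>b\<in>{1..n}. \<forall>c\<in>{1..n}.
      wins n k a b \<and> wins n k b c \<and> wins n k a c \<longrightarrow> L $ e a $ e c = L $ e a $ e b + L $ e b $ e c)"
    unfolding symplectic12_iff all_e by (simp only: \<epsilon>_e cong: ball_cong)
  also have "\<dots> \<longleftrightarrow>
    (\<forall>i j. 1 \<le> i \<and> i < j \<and> j \<le> n \<and> \<not> (j = n \<and> i \<le> k) \<longrightarrow>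
       L $ e i $ e j = (\<Sum>l=i..<j. L $ e l $ e (l + 1))) \<and>
    (\<forall>i. 2 \<le> i \<and> i \<le> k \<longrightarrow>
       L $ e i $ e n = (\<Sum>l=1..<i. L $ e l $ e (l + 1)) + L $ e 1 $ e n)"
    using assms(3,4) L_sym by (intro transitive_triples_iff_sums) auto
  finally show ?thesis .
qed

end
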